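(* Let $(r_n)_{n\ge 1}$ be a sequence of radii with $r_n \geq 4^{n/5}$ for all $n$. Then $(r_n)$ is undercooked, i.e. there is a constant $C>0$ independent of $n$ such that $\mathrm{Fav}_{\sigma^{(n)}}(\mathcal{K}_n)\geq C\,\frac{\log n}{n}$ for all $n\ge 2$, where $\sigma^{(n)}$ is the map $\sigma$ built from $f_{r_n}$ as described in the context.
   Context: Middle-half Cantor set: $\mathcal{C}_0=[0,1]$ and $\mathcal{C}_{n+1}$ is obtained from $\mathcal{C}_n$ by replacing each of its intervals by the first and last quarters of that interval (removing the middle half). Thus $\mathcal{C}_n$ is a union of $2^n$ intervals of length $4^{-n}$, and $\mathcal{K}_n:=\mathcal{C}_n\times\mathcal{C}_n\subset\mathbb{R}^2=\mathbb{C}$ is a union of $4^n$ closed squares of side $4^{-n}$. For an angle $\theta$, $\mathrm{Proj}_\theta$ denotes orthogonal projection onto the line through the origin in direction $e^{i\theta}$, and $|\cdot|$ denotes one-dimensional Lebesgue measure on that line. For a map $T:\mathbb{C}\times S^1\to\mathbb{C}$ write $T_\theta(z):=T(z,e^{i\theta})$ and define, for $E\subset\mathbb{C}$, $\mathrm{Fav}_T(E):=\frac{1}{2\pi}\int_0^{2\pi}|\mathrm{Proj}_\theta(T_\theta(E))|\,d\theta$. For $r>0$ define $f_r(y):=r-\sqrt{r^2-y^2}$ if $|y|\le 2$ and $f_r(y):=r-\sqrt{r^2-4}$ otherwise. Let $\sigma_0(x,y):=(x-f_r(y),y)$, let $R_\theta$ be clockwise rotation of the plane by the angle $\theta$, and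 set $\sigma_\theta:=R_{-\theta}\circ\sigma_0\circ R_\theta$; this defines $\sigma:\mathbb{C}\times S^1\to\mathbb{C}$ by $\sigma(z,e^{i\theta})=\sigma_\theta(z)$. A sequence of maps $T_n:\mathbb{C}\times S^1\to\mathbb{C}$ is an undercooking of the plane if there is $C>0$ independent of $n$ with $\mathrm{Fav}_{T_n}(\mathcal{K}_n)\ge C\frac{\log n}{n}$; a sequence $(r_n)$ is undercooked if the maps $\sigma$ built from $f_{r_n}$ form an undercooking. *)

theory Defs
  imports "HOL-Analysis.Analysis"
begin

text \<open>Left endpoints of the 2^n intervals (each of length 4^-n) making up the n-th
  stage of the middle-half Cantor set.  Each interval [a, a + 4^-n] is replaced by its
  first quarter [a, a + 4^-(n+1)] and its last quarter [a + 3*4^-(n+1), a + 4^-n].\<close>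
fun cantor_left :: "nat \<Rightarrow> real set" where
  "cantor_left 0 = {0}"
| "cantor_left (Suc n) =
     (\<Union>a\<in>cantor_left n. {a, a + 3 * (1/4) ^ Suc n})"

definition cantor_stage :: "nat \<Rightarrow> real set" where
  "cantor_stage n = (\<Union>a\<in>cantor_left n. {a .. a + (1/4) ^ n})"

definition K_stage :: "nat \<Rightarrow> complex set" where
  "K_stage n = {z. Re z \<in> cantor_stage n \<and> Im z \<in> cantor_stage n}"

text \<open>Coordinate of the orthogonal projection onto the line through 0 in direction
  e^{i theta}: Proj_theta z = proj_coord theta z * e^{i theta}.  Lebesgue measure on that
  line is transported isometrically to Lebesgue measure on the real line.\<close>
definition proj_coord :: "real \<Rightarrow> complex \<Rightarrow> real" where
  "proj_coord \<theta> z = Re (z * cnj (cis \<theta>))"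

definition proj_length :: "real \<Rightarrow> complex set \<Rightarrow> real" where
  "proj_length \<theta> S = measure lebesgue (proj_coord \<theta> ` S)"

definition Fav :: "(complex \<Rightarrow> complex \<Rightarrow> complex) \<Rightarrow> complex set \<Rightarrow> real" where
  "Fav T E = (1 / (2 * pi)) *
     integral {0 .. 2 * pi} (\<lambda>\<theta>. proj_length \<theta> ((\<lambda>z. T z (cis \<theta>)) ` E))"

definition f_r :: "real \<Rightarrow> real \<Rightarrow> real" where
  "f_r r y = (if \<bar>y\<bar> \<le> 2 then r - sqrt (r\<^sup>2 - y\<^sup>2) else r - sqrt (r\<^sup>2 - 4))"

definition sigma0 :: "real \<Rightarrow> complex \<Rightarrow> complex" where
  "sigma0 r w = Complex (Re w - f_r r (Im w)) (Im w)"

definition rot_cw :: "real \<Rightarrow> complex \<Rightarrow> complex" where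
  "rot_cw \<theta> z = cis (- \<theta>) * z"

text \<open>sigma_theta = R_{-theta} o sigma_0 o R_theta, and sigma(z, e^{i theta}) = sigma_theta(z).
  The second argument u is a point of the unit circle, u = e^{i theta}; we take theta = arg u.\<close>
definition sigma_map :: "real \<Rightarrow> complex \<Rightarrow> complex \<Rightarrow> complex" where
  "sigma_map r z u = rot_cw (- Arg u) (sigma0 r (rot_cw (Arg u) z))"

definition undercooking :: "(nat \<Rightarrow> complex \<Rightarrow> complex \<Rightarrow> complex) \<Rightarrow> bool" where
  "undercooking T \<longleftrightarrow>
     (\<exists>C>0. \<forall>n\<ge>2. Fav (T n) (K_stage n) \<ge> C * ln (real n) / real n)"

definition undercooked :: "(nat \<Rightarrow> real) \<Rightarrow> bool" where
  "undercooked r \<longleftrightarrow> undercooking (\<lambda>n. sigma_map (r n))"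

end

theory Submission
  imports Defs "HOL-Real_Asymp.Real_Asymp"
begin

text \<open>
  A second moment argument near the angle \<open>\<theta>\<^sub>0 = arctan (1/2)\<close>, at which the linear projections of the
  \<open>4\<^sup>n\<close> squares tile an interval in the order of their base 4 addresses. Consider angles at distance
  between \<open>4\<^sup>-\<^sup>k\<^sup>-\<^sup>1\<close> and \<open>4\<^sup>-\<^sup>k\<close> from \<open>\<theta>\<^sub>0\<close>, where \<open>4\<^sup>k \<le> n\<close>. If \<open>i\<close> is the highest position at which the
  addresses of two squares differ, then their projections can only meet when the addresses differ by
  \<open>O(1 + 4\<^sup>i\<^sup>-\<^sup>k)\<close>, hence lie that close to a common multiple of \<open>4\<^sup>i\<close>; and then they meet for a set of angles
  of measure \<open>O(4\<^sup>-\<^sup>i)\<close>, by transversality. Summing over pairs bounds the integral of the squared multiplicity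
  by \<open>O(n 16\<^sup>-\<^sup>k)\<close>, so by Cauchy--Schwarz these angles contribute at least \<open>c / n\<close>. There are about
  \<open>log n\<close> such \<open>k\<close>. A profile with slope and curvature at most \<open>\<epsilon>\<close> perturbs a projected difference vector by
  a factor \<open>O(\<epsilon>)\<close> only, which is harmless as soon as \<open>\<epsilon> \<le> 4\<^sup>-\<^sup>k\<close>; for a circle of radius \<open>r\<close> one has
  \<open>\<epsilon> = 4 / r\<close>.
\<close>

subsection \<open>Analytic preliminaries\<close>

text \<open>A linearised Cauchy--Schwarz inequality for the multiplicity with which the sets \<open>S i\<close> cover a point;
  the usual form is recovered by optimising \<open>t\<close>.\<close>
lemma measure_UN_ge_second_moment:
  fixes S :: "'i \<Rightarrow> 'a set" and t :: real
  assumes "finite A" and fmeasurable: "\<And>i. i \<in> A \<Longrightarrow> S i \<in> fmeasurable M"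
  shows "2 * t * (\<Sum>i\<in>A. measure M (S i)) - t\<^sup>2 * (\<Sum>(i, j)\<in>A \<times> A. measure M (S i \<inter> S j))
    \<le> measure M (\<Union>i\<in>A. S i)"
proof -
  define f where "f = (\<lambda>x. \<Sum>i\<in>A. indicat_real (S i) x)"
  have indicator: "has_bochner_integral M (indicat_real U) (measure M U)" if "U \<in> fmeasurable M" for U
    using that by (intro has_bochner_integral_real_indicator) (auto simp: fmeasurable_def)
  have first_moment: "has_bochner_integral M f (\<Sum>i\<in>A. measure M (S i))"
    unfolding f_def using fmeasurable by (intro has_bochner_integral_sum indicator)
  have "f x * f x = (\<Sum>(i, j)\<in>A \<times> A. indicat_real (S i \<inter> S j) x)" for x
    unfolding f_def sum_product sum.cartesian_product by (simp add: indicator_inter_arith)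
  then have second_moment:
    "has_bochner_integral M (\<lambda>x. f x * f x) (\<Sum>(i, j)\<in>A \<times> A. measure M (S i \<inter> S j))"
    unfolding case_prod_beta using fmeasurable
    by (auto intro!: has_bochner_integral_sum indicator fmeasurable.Int)
  have "2 * t * f x - t\<^sup>2 * (f x * f x) \<le> indicat_real (\<Union>i\<in>A. S i) x" for x
  proof (cases "x \<in> (\<Union>i\<in>A. S i)")
    case True
    have "0 \<le> (1 - t * f x)\<^sup>2" by simp
    then show ?thesis using True by (simp add: power2_eq_square algebra_simps)
  next
    case False
    then have "f x = 0" unfolding f_def by (auto intro!: sum.neutral simp: indicator_def)
    then show ?thesis by simp
  qed
  moreover have "has_bochner_integral M (\<lambda>x. 2 * t * f x - t\<^sup>2 * (f x * f x))
      (2 * t * (\<Sum>i\<in>A. measure M (S i)) - t\<^sup>2 * (\<Sum>(i, j)\<in>A \<times> A. measure M (S i \<inter> S j)))"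
    by (intro has_bochner_integral_diff has_bochner_integral_mult_right first_moment second_moment)
  moreover have "has_bochner_integral M (indicat_real (\<Union>i\<in>A. S i)) (measure M (\<Union>i\<in>A. S i))"
    using assms by (intro indicator fmeasurable.finite_UN)
  ultimately show ?thesis
    using integral_mono by (metis (no_types, lifting) has_bochner_integral_iff)
qed

lemma measure_UN_intervals_ge:
  fixes c :: "'i \<Rightarrow> real" and \<delta> t :: real
  assumes "finite A" and "0 \<le> \<delta>"
  shows "2 * t * (\<delta> * card A) - t\<^sup>2 * (\<delta> * (\<Sum>(i, j)\<in>A \<times> A. of_bool (\<bar>c i - c j\<bar> \<le> \<delta>)))
    \<le> measure lebesgue (\<Union>i\<in>A. {c i..c i + \<delta>})"
proof -
  let ?I = "\<lambda>i. {c i..c i + \<delta>}"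
  have "measure lebesgue (?I i \<inter> ?I j) \<le> \<delta> * of_bool (\<bar>c i - c j\<bar> \<le> \<delta>)" for i j
    using \<open>0 \<le> \<delta>\<close> by auto
  then have "(\<Sum>(i, j)\<in>A \<times> A. measure lebesgue (?I i \<inter> ?I j))
      \<le> \<delta> * (\<Sum>(i, j)\<in>A \<times> A. of_bool (\<bar>c i - c j\<bar> \<le> \<delta>))"
    unfolding sum_distrib_left by (intro sum_mono) (auto split: prod.split)
  then have "t\<^sup>2 * (\<Sum>(i, j)\<in>A \<times> A. measure lebesgue (?I i \<inter> ?I j))
      \<le> t\<^sup>2 * (\<delta> * (\<Sum>(i, j)\<in>A \<times> A. of_bool (\<bar>c i - c j\<bar> \<le> \<delta>)))"
    by (intro mult_left_mono) auto
  moreover have "(\<Sum>i\<in>A. measure lebesgue (?I i)) = \<delta> * card A"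
    using \<open>0 \<le> \<delta>\<close> by simp
  ultimately show ?thesis
    using measure_UN_ge_second_moment[OF \<open>finite A\<close>, of ?I lebesgue t] by simp
qed

lemma measure_le_if_dist_le:
  fixes S :: "real set"
  assumes "S \<in> sets lebesgue" "0 \<le> e" and diam: "\<And>s t. s \<in> S \<Longrightarrow> t \<in> S \<Longrightarrow> \<bar>s - t\<bar> \<le> e"
  shows "measure lebesgue S \<le> e"
proof (cases "S = {}")
  case False
  have upper: "s - e \<le> t" if "s \<in> S" "t \<in> S" for s t
    using diam[OF that] by linarith
  then have "bdd_below S" using False by (meson bdd_belowI equals0I)
  then have "S \<subseteq> {Inf S..Inf S + e}"
    using upper False by (auto intro: cInf_lower simp flip: diff_le_eq intro!: cInf_greatest)
  then have "measure lebesgue S \<le> measure lebesgue {Inf S..Inf S + e}"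
    using assms(1) by (intro measure_mono_fmeasurable) auto
  then show ?thesis using \<open>0 \<le> e\<close> by simp
qed (simp add: \<open>0 \<le> e\<close>)

lemma measure_image_integrable_on:
  fixes F :: "'a::euclidean_space \<Rightarrow> 'b::topological_space \<Rightarrow> 'c::euclidean_space"
  assumes "compact T" "compact K" and continuous: "continuous_on (T \<times> K) (\<lambda>(x, y). F x y)"
  shows "(\<lambda>x. measure lebesgue (F x ` K)) integrable_on T"
proof -
  define \<Gamma> where "\<Gamma> = (\<lambda>(x, y). (x, F x y)) ` (T \<times> K)"
  have "compact \<Gamma>"
    unfolding \<Gamma>_def case_prod_beta using assms
    by (intro compact_continuous_image compact_Times continuous_on_Pair continuous_intros)
       (auto simp: case_prod_beta)
  then have "\<Gamma> \<in> sets borel" and "emeasure lborel \<Gamma> < \<infinity>"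
    by (rule borel_compact, rule emeasure_compact_finite)
  then have "integrable (lborel \<Otimes>\<^sub>M lborel) (indicat_real \<Gamma>)"
    unfolding lborel_prod by (intro integrable_real_indicator) auto
  then have "integrable lborel (\<lambda>x. \<integral>z. indicat_real \<Gamma> (x, z) \<partial>lborel)"
    by (rule lborel_pair.integrable_fst')
  moreover have "(\<integral>z. indicat_real \<Gamma> (x, z) \<partial>lborel) =
      (if x \<in> T then measure lebesgue (F x ` K) else 0)" for x
  proof -
    have "(\<lambda>z. indicat_real \<Gamma> (x, z)) = indicat_real (if x \<in> T then F x ` K else {})"
      by (auto simp: \<Gamma>_def indicator_def fun_eq_iff image_iff)
    moreover have "compact (F x ` K)" if "x \<in> T"
      using that \<open>compact K\<close>
        continuous_on_compose2[OF continuous continuous_on_Pair[OF continuous_on_const continuous_on_id]]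
      by (intro compact_continuous_image) auto
    ultimately show ?thesis
      by (simp add: borel_compact measure_completion)
  qed
  ultimately have "(\<lambda>x. if x \<in> T then measure lebesgue (F x ` K) else 0) integrable_on UNIV"
    by (intro integrable_on_lborel) simp
  then show ?thesis by (simp only: Henstock_Kurzweil_Integration.integrable_restrict_UNIV)
qed

lemma norm_sum_power_scaleR_le:
  fixes x :: "nat \<Rightarrow> 'a::real_normed_vector" and q :: real
  assumes "1 < q" and "\<And>j. j < n \<Longrightarrow> norm (x j) \<le> c"
  shows "norm (\<Sum>j<n. q ^ j *\<^sub>R x j) \<le> c * (q ^ n - 1) / (q - 1)"
proof -
  have "norm (\<Sum>j<n. q ^ j *\<^sub>R x j) \<le> (\<Sum>j<n. q ^ j * c)"
    using assms by (intro sum_norm_le) (auto intro!: mult_left_mono)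
  also have "\<dots> = (\<Sum>j<n. q ^ j) * c" by (rule sum_distrib_right[symmetric])
  also have "\<dots> = c * (q ^ n - 1) / (q - 1)"
    using \<open>1 < q\<close> by (simp add: geometric_sum)
  finally show ?thesis .
qed

lemma norm_cis_diff_le: "norm (cis s - cis t) \<le> \<bar>s - t\<bar>"
proof -
  have "cis s - cis t = cis t * (cis (s - t) - 1)" by (simp add: algebra_simps cis_mult)
  then have "norm (cis s - cis t) = norm (exp (\<i> * of_real (s - t)) - 1)"
    by (simp add: norm_mult cis_conv_exp)
  also have "\<dots> = 2 * \<bar>sin ((s - t) / 2)\<bar>" by (rule dist_exp_i_1)
  also have "\<dots> \<le> 2 * \<bar>(s - t) / 2\<bar>" by (intro mult_left_mono abs_sin_x_le_abs_x) simp
  finally show ?thesis by simp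
qed

lemma abs_Re_cis_mult_le: "\<bar>Re (cis \<theta> * z)\<bar> \<le> norm z"
  using abs_Re_le_cmod[of "cis \<theta> * z"] by (simp add: norm_mult)

lemma abs_Im_cis_mult_le: "\<bar>Im (cis \<theta> * z)\<bar> \<le> norm z"
  using abs_Im_le_cmod[of "cis \<theta> * z"] by (simp add: norm_mult)

lemma ex_pos_mult_le_if_eventually:
  fixes g h :: "nat \<Rightarrow> real"
  assumes g: "\<And>n. 0 < g n" and h: "\<And>n. 0 \<le> h n"
    and "0 < c" and "\<forall>\<^sub>F n in sequentially. c * h n \<le> g n"
  shows "\<exists>C>0. \<forall>n. C * h n \<le> g n"
proof -
  obtain N where N: "\<And>n. N \<le> n \<Longrightarrow> c * h n \<le> g n"
    using assms(4) unfolding eventually_sequentially by blast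
  define C where "C = Min (insert c ((\<lambda>n. g n / (h n + 1)) ` {..<N}))"
  have "0 < C" unfolding C_def using g h \<open>0 < c\<close> by (auto simp: add_nonneg_pos)
  moreover have "C * h n \<le> g n" for n
  proof (cases "n < N")
    case True
    then have "C \<le> g n / (h n + 1)" unfolding C_def by (intro Min_le) auto
    then have "C * (h n + 1) \<le> g n" using h[of n] by (simp add: pos_le_divide_eq)
    then show ?thesis using \<open>0 < C\<close> by (simp add: algebra_simps)
  next
    case False
    have "C * h n \<le> c * h n" unfolding C_def using h by (intro mult_right_mono Min_le) auto
    then show ?thesis using N[of n] False by linarith
  qed
  ultimately show ?thesis by blast
qed

subsection \<open>Digits and pairs of nearby numbers\<close>

definition digit :: "nat \<Rightarrow> nat \<Rightarrow> nat \<Rightarrow> nat" where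
  "digit b j m = m div b ^ j mod b"

lemma sum_digit: "(\<Sum>j<n. b ^ j * digit b j m) = m mod b ^ n"
proof (induction n)
  case (Suc n)
  have "m mod b ^ Suc n = b ^ n * (m div b ^ n mod b) + m mod b ^ n"
    unfolding power_Suc2 by (rule mod_mult2_eq)
  then show ?case using Suc.IH by (simp add: digit_def)
qed simp

definition top_differing_digit :: "nat \<Rightarrow> nat \<Rightarrow> nat \<Rightarrow> nat \<Rightarrow> bool" where
  "top_differing_digit b i m m' \<longleftrightarrow>
    digit b i m \<noteq> digit b i m' \<and> (\<forall>j>i. digit b j m = digit b j m')"

lemma top_differing_digit_exists:
  assumes m: "m < b ^ n" and m': "m' < b ^ n" and "m \<noteq> m'"
  obtains i where "i < n" "top_differing_digit b i m m'"
proof -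
  define D where "D = {j. j < n \<and> digit b j m \<noteq> digit b j m'}"
  have "finite D" by (simp add: D_def)
  have "D \<noteq> {}"
  proof
    assume "D = {}"
    then have "(\<Sum>j<n. b ^ j * digit b j m) = (\<Sum>j<n. b ^ j * digit b j m')"
      by (intro sum.cong) (auto simp: D_def)
    then show False using assms by (simp add: sum_digit)
  qed
  have "digit b j m = digit b j m'" if "Max D < j" for j
  proof (cases "j < n")
    case True
    have "j \<notin> D" using that \<open>finite D\<close> by (auto dest: Max_ge)
    then show ?thesis using True by (simp add: D_def)
  next
    case False
    have "1 \<le> b" using assms by (cases b; cases n) auto
    then have "b ^ n \<le> b ^ j" using False by (intro power_increasing) auto
    then show ?thesis using m m' by (simp add: digit_def)
  qed
  moreover have "Max D < n" "digit b (Max D) m \<noteq> digit b (Max D) m'"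
    using Max_in[OF \<open>finite D\<close> \<open>D \<noteq> {}\<close>] unfolding D_def by blast+
  ultimately show thesis
    by (intro that[of "Max D"]) (simp_all add: top_differing_digit_def)
qed

lemma div_neq_if_top_differing_digit:
  "top_differing_digit b i m m' \<Longrightarrow> m div b ^ i \<noteq> m' div b ^ i"
  by (auto simp: top_differing_digit_def digit_def)

lemma
  fixes x M :: real
  assumes "0 \<le> M"
  shows finite_nat_near: "finite {m. \<bar>real m - x\<bar> \<le> M}"
    and card_nat_near_le: "card {m. \<bar>real m - x\<bar> \<le> M} \<le> 2 * M + 1"
proof -
  have image: "int ` {m. \<bar>real m - x\<bar> \<le> M} \<subseteq> {\<lceil>x - M\<rceil>..\<lfloor>x + M\<rfloor>}"
    by (auto simp: ceiling_le_iff le_floor_iff)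
  then show "finite {m. \<bar>real m - x\<bar> \<le> M}"
    by (meson finite_atLeastAtMost_int finite_imageD finite_subset inj_on_of_nat)
  have "card {m. \<bar>real m - x\<bar> \<le> M} \<le> card {\<lceil>x - M\<rceil>..\<lfloor>x + M\<rfloor>}"
    using image by (intro card_inj_on_le[where f = int]) auto
  also have "\<dots> = nat (\<lfloor>x + M\<rfloor> - \<lceil>x - M\<rceil> + 1)" by simp
  finally show "card {m. \<bar>real m - x\<bar> \<le> M} \<le> 2 * M + 1"
    using assms of_int_floor_le[of "x + M"] le_of_int_ceiling[of "x - M"]
    by (cases "\<lfloor>x + M\<rfloor> - \<lceil>x - M\<rceil> + 1 \<ge> 0") linarith+
qed

definition near_pairs :: "nat \<Rightarrow> real \<Rightarrow> (nat \<times> nat) set" where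
  "near_pairs N M = {(m, m'). m < N \<and> m' < N \<and> \<bar>real m - real m'\<bar> \<le> M}"

lemma near_pairs_subset: "near_pairs N M \<subseteq> {..<N} \<times> {..<N}"
  by (auto simp: near_pairs_def)

lemma card_near_pairs_le:
  fixes M :: real
  assumes "0 \<le> M"
  shows "card (near_pairs N M) \<le> N * (2 * M + 1)"
proof -
  let ?near = "\<lambda>m. {m'. \<bar>real m' - real m\<bar> \<le> M}"
  have "card (near_pairs N M) \<le> card (SIGMA m:{..<N}. ?near m)"
    using assms by (intro card_mono finite_SigmaI finite_nat_near)
      (auto simp: near_pairs_def abs_minus_commute)
  also have "\<dots> = (\<Sum>m<N. card (?near m))"
    using assms finite_nat_near by (intro card_SigmaI) auto
  finally have "real (card (near_pairs N M)) \<le> (\<Sum>m<N. real (card (?near m)))"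
    by (simp flip: of_nat_sum)
  also have "\<dots> \<le> real (card {..<N}) * (2 * M + 1)"
    using assms by (intro sum_bounded_above card_nat_near_le)
  finally show ?thesis by simp
qed

definition straddling_pairs :: "nat \<Rightarrow> nat \<Rightarrow> real \<Rightarrow> (nat \<times> nat) set" where
  "straddling_pairs N q M = {(m, m') \<in> near_pairs N M. m div q \<noteq> m' div q}"

lemma straddling_pairs_subset: "straddling_pairs N q M \<subseteq> {..<N} \<times> {..<N}"
  by (auto simp: straddling_pairs_def near_pairs_def)

lemma block_boundary_between:
  fixes q :: nat
  assumes "0 < q" "m div q < m' div q"
  shows "m < m' div q * q" "m' div q * q \<le> m'"
  using assms by (auto simp flip: div_less_iff_less_mult)

text \<open>Between two numbers in different blocks of length \<open>q\<close> there is a multiple of \<open>q\<close>,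
  to which both are close.\<close>
lemma card_straddling_pairs_le:
  fixes M :: real
  assumes "0 < q" "0 \<le> M"
  shows "card (straddling_pairs (N * q) q M) \<le> N * (2 * M + 1)\<^sup>2"
proof -
  let ?near = "\<lambda>k. {m. \<bar>real m - real (k * q)\<bar> \<le> M}"
  have close: "(m, m') \<in> (\<Union>k<N. ?near k \<times> ?near k)"
    if "m' < N * q" "\<bar>real m - real m'\<bar> \<le> M" "m div q < m' div q" for m m'
  proof (rule UN_I)
    show "m' div q \<in> {..<N}" using that(1) by (simp add: less_mult_imp_div_less)
    have "real m \<le> real (m' div q * q)" "real (m' div q * q) \<le> real m'"
      using block_boundary_between[OF \<open>0 < q\<close> that(3)] by (simp_all only: of_nat_le_iff less_imp_le)
    then show "(m, m') \<in> ?near (m' div q) \<times> ?near (m' div q)"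
      using that(2) by (simp add: abs_le_iff)
  qed
  have "(m, m') \<in> (\<Union>k<N. ?near k \<times> ?near k)"
    if "(m, m') \<in> straddling_pairs (N * q) q M" for m m'
    using that close[of m' m] close[of m m']
    by (cases "m div q < m' div q") (auto simp: straddling_pairs_def near_pairs_def abs_minus_commute)
  then have "card (straddling_pairs (N * q) q M) \<le> card (\<Union>k<N. ?near k \<times> ?near k)"
    using \<open>0 \<le> M\<close> by (intro card_mono) (auto intro: finite_nat_near)
  also have "\<dots> \<le> (\<Sum>k<N. card (?near k \<times> ?near k))"
    by (rule card_UN_le) simp
  finally have "real (card (straddling_pairs (N * q) q M))
      \<le> (\<Sum>k<N. (real (card (?near k)))\<^sup>2)"
    by (simp add: card_cartesian_product power2_eq_square flip: of_nat_sum of_nat_mult)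
  also have "\<dots> \<le> real (card {..<N}) * (2 * M + 1)\<^sup>2"
    using \<open>0 \<le> M\<close> by (intro sum_bounded_above power_mono card_nat_near_le) auto
  finally show ?thesis by simp
qed

subsection \<open>Addresses of the squares\<close>

text \<open>The digits 0, 1, 2, 3 enumerate the quarters of a square so that \<open>2 x + y\<close> increases.
  Thus \<open>corner n m\<close> is the lower left corner of the square of \<open>K_stage n\<close> whose address is \<open>m < 4\<^sup>n\<close>.\<close>
definition digit_vector :: "nat \<Rightarrow> complex" where
  "digit_vector d = Complex (3 * real (d div 2)) (3 * real (d mod 2))"

definition corner :: "nat \<Rightarrow> nat \<Rightarrow> complex" where
  "corner n m = (\<Sum>j<n. 4 ^ j *\<^sub>R digit_vector (digit 4 j m)) /\<^sub>R 4 ^ n"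

lemma norm_digit_vector_diff_le:
  assumes "d < 4" "d' < 4"
  shows "norm (digit_vector d - digit_vector d') \<le> 6"
proof -
  have "d div 2 \<le> 1" "d' div 2 \<le> 1" "d mod 2 \<le> 1" "d' mod 2 \<le> 1" using assms by auto
  then have "\<bar>Re (digit_vector d - digit_vector d')\<bar> \<le> 3" "\<bar>Im (digit_vector d - digit_vector d')\<bar> \<le> 3"
    unfolding digit_vector_def by auto
  then show ?thesis using cmod_le[of "digit_vector d - digit_vector d'"] by linarith
qed

lemma norm_digit_vector_diff_ge:
  assumes "d \<noteq> d'"
  shows "3 \<le> norm (digit_vector d - digit_vector d')"
proof -
  have "d div 2 \<noteq> d' div 2 \<or> d mod 2 \<noteq> d' mod 2"
    using assms by (metis div_mult_mod_eq)
  then have "3 \<le> \<bar>Re (digit_vector d - digit_vector d')\<bar> \<or> 3 \<le> \<bar>Im (digit_vector d - digit_vector d')\<bar>"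
    unfolding digit_vector_def by auto
  then show ?thesis
    using abs_Re_le_cmod[of "digit_vector d - digit_vector d'"]
      abs_Im_le_cmod[of "digit_vector d - digit_vector d'"] by linarith
qed

lemma norm_corner_less: "norm (corner n m) < 2"
proof -
  have "digit_vector 0 = 0" by (simp add: digit_vector_def complex_eq_iff)
  then have "norm (digit_vector (digit 4 j m)) \<le> 6" for j
    using norm_digit_vector_diff_le[of "digit 4 j m" 0] by (simp add: digit_def)
  then have "norm (\<Sum>j<n. 4 ^ j *\<^sub>R digit_vector (digit 4 j m)) \<le> 6 * (4 ^ n - 1) / (4 - 1)"
    by (intro norm_sum_power_scaleR_le) auto
  then show ?thesis by (simp add: corner_def field_simps)
qed

lemma corner_diff_eq_sum_le_top_differing_digit:
  assumes "i < n" "top_differing_digit 4 i m m'"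
  shows "corner n m - corner n m' =
    (\<Sum>j<Suc i. 4 ^ j *\<^sub>R (digit_vector (digit 4 j m) - digit_vector (digit 4 j m'))) /\<^sub>R 4 ^ n"
proof -
  have "corner n m - corner n m' =
      (\<Sum>j<n. 4 ^ j *\<^sub>R (digit_vector (digit 4 j m) - digit_vector (digit 4 j m'))) /\<^sub>R 4 ^ n"
    by (simp add: corner_def sum_subtractf scaleR_diff_right)
  also have "(\<Sum>j<n. 4 ^ j *\<^sub>R (digit_vector (digit 4 j m) - digit_vector (digit 4 j m')))
      = (\<Sum>j<Suc i. 4 ^ j *\<^sub>R (digit_vector (digit 4 j m) - digit_vector (digit 4 j m')))"
    using assms by (intro sum.mono_neutral_right) (auto simp: top_differing_digit_def)
  finally show ?thesis .
qed

lemma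
  assumes "i < n" "top_differing_digit 4 i m m'"
  shows norm_corner_diff_le: "norm (corner n m - corner n m') \<le> 8 * 4 ^ i / 4 ^ n"
    and norm_corner_diff_ge: "4 ^ i / 4 ^ n \<le> norm (corner n m - corner n m')"
proof -
  define v where "v = (\<lambda>j. digit_vector (digit 4 j m) - digit_vector (digit 4 j m'))"
  define lower where "lower = (\<Sum>j<i. 4 ^ j *\<^sub>R v j)"
  have "norm (v j) \<le> 6" for j
    unfolding v_def by (intro norm_digit_vector_diff_le) (simp_all add: digit_def)
  then have "norm lower \<le> 6 * (4 ^ i - 1) / (4 - 1)"
    unfolding lower_def by (intro norm_sum_power_scaleR_le) auto
  then have lower: "norm lower \<le> 2 * 4 ^ i" by simp
  have "4 ^ i * norm (v i) \<le> 4 ^ i * 6" "4 ^ i * 3 \<le> 4 ^ i * norm (v i)"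
    using \<open>norm (v i) \<le> 6\<close> norm_digit_vector_diff_ge assms(2)
    unfolding v_def top_differing_digit_def by (intro mult_left_mono; simp)+
  then have leading: "norm (4 ^ i *\<^sub>R v i) \<le> 6 * 4 ^ i" "3 * 4 ^ i \<le> norm (4 ^ i *\<^sub>R v i)"
    by (simp_all add: mult.commute)
  have "norm (corner n m - corner n m') = norm (lower + 4 ^ i *\<^sub>R v i) / 4 ^ n"
    unfolding corner_diff_eq_sum_le_top_differing_digit[OF assms] v_def lower_def
    by (simp add: divide_inverse_commute)
  moreover have "norm (lower + 4 ^ i *\<^sub>R v i) \<le> 8 * 4 ^ i"
    using norm_triangle_ineq[of lower "4 ^ i *\<^sub>R v i"] lower leading by linarith
  moreover have "4 ^ i \<le> norm (lower + 4 ^ i *\<^sub>R v i)"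
    using norm_diff_ineq[of "4 ^ i *\<^sub>R v i" lower] lower leading
    unfolding add.commute[of lower] by linarith
  ultimately show "norm (corner n m - corner n m') \<le> 8 * 4 ^ i / 4 ^ n"
    and "4 ^ i / 4 ^ n \<le> norm (corner n m - corner n m')"
    by (simp_all add: divide_right_mono)
qed

lemma sum_thrice_bits_mem_cantor_left:
  assumes "\<And>j. e j \<in> {0, 1 :: nat}"
  shows "(\<Sum>j<n. 4 ^ j * (3 * real (e j))) / 4 ^ n \<in> cantor_left n"
  using assms
proof (induction n arbitrary: e)
  case (Suc n)
  have "(\<Sum>j<Suc n. 4 ^ j * (3 * real (e j))) / 4 ^ Suc n
      = (\<Sum>j<n. 4 ^ j * (3 * real (e (Suc j)))) / 4 ^ n + real (e 0) * (3 * (1 / 4) ^ Suc n)"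
    unfolding sum.lessThan_Suc_shift
    by (simp add: sum_distrib_left field_simps power_one_over)
  moreover have "(\<Sum>j<n. 4 ^ j * (3 * real (e (Suc j)))) / 4 ^ n \<in> cantor_left n"
    using Suc.prems by (rule Suc.IH)
  ultimately show ?case
    unfolding cantor_left.simps using Suc.prems[of 0] by (auto simp del: power_Suc)
qed simp

lemma Re_corner_mem_cantor_left: "Re (corner n m) \<in> cantor_left n"
  using sum_thrice_bits_mem_cantor_left[of "\<lambda>j. digit 4 j m div 2" n]
  by (force simp: corner_def digit_vector_def digit_def divide_inverse_commute)

lemma Im_corner_mem_cantor_left: "Im (corner n m) \<in> cantor_left n"
  using sum_thrice_bits_mem_cantor_left[of "\<lambda>j. digit 4 j m mod 2" n]
  by (force simp: corner_def digit_vector_def digit_def divide_inverse_commute)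

lemma corner_ray_mem_K_stage:
  assumes \<theta>: "\<theta> \<in> {0..pi / 2}" and s: "s \<in> {0..1 / 4 ^ n}"
  shows "corner n m + s *\<^sub>R cis \<theta> \<in> K_stage n"
proof -
  have "s * cos \<theta> \<in> {0..1 / 4 ^ n}" "s * sin \<theta> \<in> {0..1 / 4 ^ n}"
    using \<theta> s mult_mono[of s "1 / 4 ^ n" "cos \<theta>" 1] mult_mono[of s "1 / 4 ^ n" "sin \<theta>" 1]
    by (auto simp: cos_ge_zero sin_ge_zero)
  moreover have "a + x \<in> cantor_stage n" if "a \<in> cantor_left n" "x \<in> {0..1 / 4 ^ n}" for a x
    unfolding cantor_stage_def using that by (intro UN_I[of a]) (auto simp: power_one_over)
  ultimately show ?thesis
    using Re_corner_mem_cantor_left Im_corner_mem_cantor_left by (simp add: K_stage_def)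
qed

lemma two_Re_add_Im_corner:
  assumes "m < 4 ^ n"
  shows "2 * Re (corner n m) + Im (corner n m) = 3 * real m / 4 ^ n"
proof -
  have "2 * Re (corner n m) + Im (corner n m)
      = (\<Sum>j<n. 4 ^ j * (2 * Re (digit_vector (digit 4 j m)) + Im (digit_vector (digit 4 j m)))) / 4 ^ n"
    by (simp add: corner_def sum_distrib_left sum.distrib algebra_simps divide_inverse_commute)
  also have "\<dots> = (\<Sum>j<n. 4 ^ j * (3 * real (digit 4 j m))) / 4 ^ n"
  proof -
    have "2 * Re (digit_vector d) + Im (digit_vector d) = 3 * real d" for d
    proof -
      have "real (2 * (d div 2) + d mod 2) = real d" by (simp only: mult_div_mod_eq)
      then show ?thesis unfolding of_nat_add of_nat_mult by (simp add: digit_vector_def)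
    qed
    then show ?thesis by simp
  qed
  also have "\<dots> = 3 * real (\<Sum>j<n. 4 ^ j * digit 4 j m) / 4 ^ n"
    by (simp add: sum_distrib_left mult.left_commute)
  also have "\<dots> = 3 * real m / 4 ^ n"
    unfolding sum_digit using assms by simp
  finally show ?thesis .
qed

lemma compact_K_stage: "compact (K_stage n)"
proof -
  have "finite (cantor_left n)" by (induction n) auto
  then have "compact (cantor_stage n)"
    unfolding cantor_stage_def by (intro compact_UN) auto
  then have "compact ((\<lambda>(x, y). Complex x y) ` (cantor_stage n \<times> cantor_stage n))"
    unfolding case_prod_beta Complex_eq
    by (intro compact_continuous_image compact_Times continuous_intros)
  also have "(\<lambda>(x, y). Complex x y) ` (cantor_stage n \<times> cantor_stage n) = K_stage n"
    unfolding K_stage_def by (auto simp: image_iff complex_eq_iff)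
  finally show ?thesis .
qed

subsection \<open>Curved projections\<close>

definition curved_proj :: "(real \<Rightarrow> real) \<Rightarrow> real \<Rightarrow> complex \<Rightarrow> real" where
  "curved_proj f \<theta> z = Re (cis (- \<theta>) * z) - f (Im (cis (- \<theta>) * z))"

definition shadow_length :: "(real \<Rightarrow> real) \<Rightarrow> complex set \<Rightarrow> real \<Rightarrow> real" where
  "shadow_length f K \<theta> = measure lebesgue (curved_proj f \<theta> ` K)"

definition coincidence_angles :: "(real \<Rightarrow> real) \<Rightarrow> real \<Rightarrow> complex \<Rightarrow> complex \<Rightarrow> real set" where
  "coincidence_angles f \<delta> a b = {\<theta>. \<bar>curved_proj f \<theta> a - curved_proj f \<theta> b\<bar> \<le> \<delta>}"

text \<open>The perturbation depends only on the coordinate orthogonal to the direction of projection.\<close>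
lemma curved_proj_add_ray: "curved_proj f \<theta> (z + s *\<^sub>R cis \<theta>) = curved_proj f \<theta> z + s"
proof -
  have "cis (- \<theta>) * (z + s *\<^sub>R cis \<theta>) = cis (- \<theta>) * z + of_real s"
    by (simp add: distrib_left cis_mult scaleR_conv_of_real)
  then show ?thesis by (simp add: curved_proj_def)
qed

context
  fixes f :: "real \<Rightarrow> real"
  assumes f: "continuous_on UNIV f"
begin

lemma continuous_on_curved_proj [continuous_intros]:
  assumes "continuous_on S \<theta>" "continuous_on S z"
  shows "continuous_on S (\<lambda>x. curved_proj f (\<theta> x) (z x))"
  unfolding curved_proj_def
  by (intro continuous_intros continuous_on_compose2[OF f] assms) simp

lemma closed_coincidence_angles: "closed (coincidence_angles f \<delta> a b)"
  unfolding coincidence_angles_def by (intro closed_Collect_le continuous_intros)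

lemma coincidence_angles_Int_lmeasurable:
  "compact T \<Longrightarrow> coincidence_angles f \<delta> a b \<inter> T \<in> lmeasurable"
  by (intro lmeasurable_compact closed_Int_compact closed_coincidence_angles)

lemma shadow_length_integrable_on:
  "compact K \<Longrightarrow> compact T \<Longrightarrow> shadow_length f K integrable_on T"
  unfolding shadow_length_def case_prod_beta
  by (intro measure_image_integrable_on) (auto simp: case_prod_beta intro!: continuous_intros)

lemma shadow_length_ge:
  assumes "compact K" and "finite A" and "0 \<le> \<delta>"
    and rays: "\<And>i s. i \<in> A \<Longrightarrow> s \<in> {0..\<delta>} \<Longrightarrow> c i + s *\<^sub>R cis \<theta> \<in> K"
  shows "2 * t * (\<delta> * card A) - t\<^sup>2 *
      (\<delta> * (\<Sum>(i, j)\<in>A \<times> A. indicat_real (coincidence_angles f \<delta> (c i) (c j)) \<theta>))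
    \<le> shadow_length f K \<theta>"
proof -
  let ?I = "\<lambda>i. {curved_proj f \<theta> (c i)..curved_proj f \<theta> (c i) + \<delta>}"
  have "?I i \<subseteq> curved_proj f \<theta> ` K" if "i \<in> A" for i
  proof
    fix x assume "x \<in> ?I i"
    then show "x \<in> curved_proj f \<theta> ` K"
      using rays[OF that, of "x - curved_proj f \<theta> (c i)"]
      by (intro image_eqI[where x = "c i + (x - curved_proj f \<theta> (c i)) *\<^sub>R cis \<theta>"])
        (auto simp: curved_proj_add_ray)
  qed
  moreover have "curved_proj f \<theta> ` K \<in> lmeasurable"
    using \<open>compact K\<close> by (intro lmeasurable_compact compact_continuous_image continuous_intros)
  ultimately have "measure lebesgue (\<Union>i\<in>A. ?I i) \<le> shadow_length f K \<theta>"
    unfolding shadow_length_def using \<open>finite A\<close>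
    by (intro measure_mono_fmeasurable) (auto intro: sets.finite_UN)
  then show ?thesis
    using measure_UN_intervals_ge[OF \<open>finite A\<close> \<open>0 \<le> \<delta>\<close>, of t "\<lambda>i. curved_proj f \<theta> (c i)"]
    by (simp add: indicator_def coincidence_angles_def)
qed

lemma integral_shadow_length_ge:
  assumes compact: "compact K" "compact T" and "finite A" and "0 \<le> \<delta>"
    and rays: "\<And>i \<theta> s. i \<in> A \<Longrightarrow> \<theta> \<in> T \<Longrightarrow> s \<in> {0..\<delta>} \<Longrightarrow> c i + s *\<^sub>R cis \<theta> \<in> K"
  shows "2 * t * (\<delta> * card A) * measure lebesgue T - t\<^sup>2 *
      (\<delta> * (\<Sum>(i, j)\<in>A \<times> A. measure lebesgue (coincidence_angles f \<delta> (c i) (c j) \<inter> T)))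
    \<le> integral T (shadow_length f K)"
proof -
  define h where "h = (\<lambda>\<theta>. 2 * t * (\<delta> * card A) * indicat_real UNIV \<theta> - t\<^sup>2 *
    (\<delta> * (\<Sum>(i, j)\<in>A \<times> A. indicat_real (coincidence_angles f \<delta> (c i) (c j)) \<theta>)))"
  have integral_indicator: "(indicat_real S has_integral measure lebesgue (S \<inter> T)) T"
    if "S \<inter> T \<in> lmeasurable" for S
    using that by (simp add: has_integral_iff integral_indicator integrable_on_indicator)
  have "(h has_integral 2 * t * (\<delta> * card A) * measure lebesgue (UNIV \<inter> T) - t\<^sup>2 *
      (\<delta> * (\<Sum>p\<in>A \<times> A. measure lebesgue (coincidence_angles f \<delta> (c (fst p)) (c (snd p)) \<inter> T)))) T"
    unfolding h_def case_prod_beta using \<open>finite A\<close> compact(2)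
    by (intro has_integral_diff has_integral_mult_right has_integral_sum integral_indicator
        coincidence_angles_Int_lmeasurable) (auto intro: lmeasurable_compact)
  moreover have "h \<theta> \<le> shadow_length f K \<theta>" if "\<theta> \<in> T" for \<theta>
    unfolding h_def using shadow_length_ge[OF compact(1) \<open>finite A\<close> \<open>0 \<le> \<delta>\<close> rays[OF _ that]] by simp
  ultimately show ?thesis
    using shadow_length_integrable_on[OF compact]
    by (auto simp: case_prod_beta dest!: has_integral_le[OF _ integrable_integral])
qed

end

locale flat_profile =
  fixes f f' :: "real \<Rightarrow> real" and \<epsilon> :: real
  assumes continuous: "continuous_on UNIV f"
    and derivative: "\<bar>y\<bar> < 2 \<Longrightarrow> (f has_real_derivative f' y) (at y)"
    and slope_le: "\<bar>y\<bar> < 2 \<Longrightarrow> \<bar>f' y\<bar> \<le> \<epsilon>"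
    and slope_lipschitz: "\<bar>x\<bar> < 2 \<Longrightarrow> \<bar>y\<bar> < 2 \<Longrightarrow> \<bar>f' x - f' y\<bar> \<le> \<epsilon> * \<bar>x - y\<bar>"
    and flat: "\<epsilon> \<le> 1 / 16"
begin

lemma \<epsilon>_nonneg: "0 \<le> \<epsilon>"
  using slope_le[of 0] by simp

lemma profile_lipschitz:
  assumes "\<bar>x\<bar> < 2" "\<bar>y\<bar> < 2"
  shows "\<bar>f x - f y\<bar> \<le> \<epsilon> * \<bar>x - y\<bar>"
proof (rule field_differentiable_bound[of "{-2<..<2}" f f', unfolded real_norm_def])
  fix z :: real assume "z \<in> {-2<..<2}"
  then have "\<bar>z\<bar> < 2" by auto
  then show "(f has_real_derivative f' z) (at z within {-2<..<2})" "\<bar>f' z\<bar> \<le> \<epsilon>"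
    by (auto intro: has_field_derivative_at_within derivative slope_le)
qed (use assms in auto)

lemma curved_proj_diff_linear_le:
  assumes "norm a < 2" "norm b < 2"
  shows "\<bar>curved_proj f \<theta> a - curved_proj f \<theta> b - Re (cis (- \<phi>) * (a - b))\<bar>
    \<le> (\<epsilon> + \<bar>\<theta> - \<phi>\<bar>) * norm (a - b)"
proof -
  let ?x = "Im (cis (- \<theta>) * a)" and ?y = "Im (cis (- \<theta>) * b)"
  have "\<bar>?x\<bar> < 2" "\<bar>?y\<bar> < 2"
    using assms by (meson abs_Im_cis_mult_le le_less_trans)+
  then have "\<bar>f ?x - f ?y\<bar> \<le> \<epsilon> * \<bar>?x - ?y\<bar>" by (rule profile_lipschitz)
  also have "?x - ?y = Im (cis (- \<theta>) * (a - b))" by (simp add: algebra_simps)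
  also have "\<epsilon> * \<bar>\<dots>\<bar> \<le> \<epsilon> * norm (a - b)"
    by (intro mult_left_mono abs_Im_cis_mult_le \<epsilon>_nonneg)
  finally have perturbation: "\<bar>f ?x - f ?y\<bar> \<le> \<epsilon> * norm (a - b)" .
  have "\<bar>Re ((cis (- \<theta>) - cis (- \<phi>)) * (a - b))\<bar> \<le> norm (cis (- \<theta>) - cis (- \<phi>)) * norm (a - b)"
    by (metis abs_Re_le_cmod norm_mult)
  also have "\<dots> \<le> \<bar>\<theta> - \<phi>\<bar> * norm (a - b)"
    using norm_cis_diff_le[of "- \<theta>" "- \<phi>"] by (intro mult_right_mono) auto
  finally have rotation: "\<bar>Re ((cis (- \<theta>) - cis (- \<phi>)) * (a - b))\<bar> \<le> \<bar>\<theta> - \<phi>\<bar> * norm (a - b)" .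
  have "curved_proj f \<theta> a - curved_proj f \<theta> b - Re (cis (- \<phi>) * (a - b))
      = Re ((cis (- \<theta>) - cis (- \<phi>)) * (a - b)) - (f ?x - f ?y)"
    by (simp add: curved_proj_def algebra_simps)
  then show ?thesis using perturbation rotation unfolding distrib_right by linarith
qed

definition angular_speed :: "real \<Rightarrow> complex \<Rightarrow> real" where
  "angular_speed \<theta> z = Im (cis (- \<theta>) * z) + f' (Im (cis (- \<theta>) * z)) * Re (cis (- \<theta>) * z)"

lemma curved_proj_has_derivative:
  assumes "norm z < 2"
  shows "((\<lambda>\<theta>. curved_proj f \<theta> z) has_real_derivative angular_speed \<theta> z) (at \<theta>)"
proof -
  have "\<bar>Im (cis (- \<theta>) * z)\<bar> < 2"
    using assms by (meson abs_Im_cis_mult_le le_less_trans)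
  then have "(f has_real_derivative f' (Im (cis (- \<theta>) * z))) (at (Im (cis (- \<theta>) * z)))"
    by (rule derivative)
  moreover have "((\<lambda>\<theta>. Im (cis (- \<theta>) * z)) has_real_derivative - Re (cis (- \<theta>) * z)) (at \<theta>)"
    and "((\<lambda>\<theta>. Re (cis (- \<theta>) * z)) has_real_derivative Im (cis (- \<theta>) * z)) (at \<theta>)"
    by (auto intro!: derivative_eq_intros)
  ultimately have "((\<lambda>\<theta>. curved_proj f \<theta> z) has_real_derivative
      Im (cis (- \<theta>) * z) - f' (Im (cis (- \<theta>) * z)) * - Re (cis (- \<theta>) * z)) (at \<theta>)"
    unfolding curved_proj_def by (intro DERIV_diff DERIV_chain2[of f])
  then show ?thesis by (simp only: angular_speed_def mult_minus_right diff_minus_eq_add)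
qed

lemma angular_speed_diff_ge:
  assumes "norm a < 2" "norm b < 2"
  shows "\<bar>Im (cis (- \<theta>) * (a - b))\<bar> - 3 * \<epsilon> * norm (a - b) \<le> \<bar>angular_speed \<theta> a - angular_speed \<theta> b\<bar>"
proof -
  define u v where "u = cis (- \<theta>) * a" and "v = cis (- \<theta>) * b"
  have diff: "u - v = cis (- \<theta>) * (a - b)" by (simp add: u_def v_def algebra_simps)
  then have Re_diff: "\<bar>Re u - Re v\<bar> \<le> norm (a - b)" and Im_diff: "\<bar>Im u - Im v\<bar> \<le> norm (a - b)"
    by (metis abs_Re_cis_mult_le minus_complex.sel(1), metis abs_Im_cis_mult_le minus_complex.sel(2))
  have bounds: "\<bar>Re u\<bar> < 2" "\<bar>Im u\<bar> < 2" "\<bar>Im v\<bar> < 2"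
    using assms unfolding u_def v_def
    by (meson abs_Re_cis_mult_le abs_Im_cis_mult_le le_less_trans)+
  have "f' (Im u) * Re u - f' (Im v) * Re v = (f' (Im u) - f' (Im v)) * Re u + f' (Im v) * (Re u - Re v)"
    by (simp add: algebra_simps)
  then have "\<bar>f' (Im u) * Re u - f' (Im v) * Re v\<bar>
      \<le> \<bar>f' (Im u) - f' (Im v)\<bar> * \<bar>Re u\<bar> + \<bar>f' (Im v)\<bar> * \<bar>Re u - Re v\<bar>"
    by (metis abs_mult abs_triangle_ineq)
  also have "\<dots> \<le> (\<epsilon> * norm (a - b)) * 2 + \<epsilon> * norm (a - b)"
  proof (intro add_mono mult_mono)
    have "\<bar>f' (Im u) - f' (Im v)\<bar> \<le> \<epsilon> * \<bar>Im u - Im v\<bar>" using bounds by (intro slope_lipschitz)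
    also have "\<dots> \<le> \<epsilon> * norm (a - b)" using Im_diff \<epsilon>_nonneg by (rule mult_left_mono)
    finally show "\<bar>f' (Im u) - f' (Im v)\<bar> \<le> \<epsilon> * norm (a - b)" .
  qed (use bounds Re_diff \<epsilon>_nonneg slope_le in auto)
  finally have "\<bar>f' (Im u) * Re u - f' (Im v) * Re v\<bar> \<le> 3 * \<epsilon> * norm (a - b)" by simp
  moreover have "angular_speed \<theta> a - angular_speed \<theta> b
      = Im (u - v) + (f' (Im u) * Re u - f' (Im v) * Re v)"
    by (simp add: angular_speed_def u_def v_def)
  ultimately show ?thesis unfolding diff by linarith
qed

lemma angular_speed_diff_ge_near_coincidence:
  assumes a: "norm a < 2" and b: "norm b < 2" and "\<delta> \<le> norm (a - b) / 4"
    and s: "s \<in> coincidence_angles f \<delta> a b" and "\<bar>s - \<theta>\<bar> \<le> 1 / 4"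
  shows "norm (a - b) / 4 \<le> \<bar>angular_speed \<theta> a - angular_speed \<theta> b\<bar>"
proof -
  define w where "w = cis (- \<theta>) * (a - b)"
  have slack: "\<epsilon> * norm (a - b) \<le> 1 / 16 * norm (a - b)"
    and "\<bar>s - \<theta>\<bar> * norm (a - b) \<le> 1 / 4 * norm (a - b)"
    using flat \<open>\<bar>s - \<theta>\<bar> \<le> 1 / 4\<close> by (intro mult_right_mono; simp)+
  moreover have "\<bar>curved_proj f s a - curved_proj f s b - Re w\<bar> \<le> \<epsilon> * norm (a - b) + \<bar>s - \<theta>\<bar> * norm (a - b)"
    unfolding w_def distrib_right[symmetric] by (rule curved_proj_diff_linear_le[OF a b])
  moreover have "\<bar>curved_proj f s a - curved_proj f s b\<bar> \<le> norm (a - b) / 4"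
    using s \<open>\<delta> \<le> norm (a - b) / 4\<close> by (simp add: coincidence_angles_def)
  ultimately have "\<bar>Re w\<bar> \<le> 9 / 16 * norm (a - b)" by linarith
  moreover have "norm (a - b) \<le> \<bar>Re w\<bar> + \<bar>Im w\<bar>"
    using cmod_le[of w] by (simp add: w_def norm_mult)
  moreover have "\<bar>Im w\<bar> - 3 * \<epsilon> * norm (a - b) \<le> \<bar>angular_speed \<theta> a - angular_speed \<theta> b\<bar>"
    unfolding w_def by (rule angular_speed_diff_ge[OF a b])
  ultimately show ?thesis using slack by linarith
qed

lemma coincidence_angles_close:
  assumes a: "norm a < 2" and b: "norm b < 2" and \<delta>: "\<delta> \<le> norm (a - b) / 4"
    and "s \<in> coincidence_angles f \<delta> a b" "t \<in> coincidence_angles f \<delta> a b" "\<bar>s - t\<bar> \<le> 1 / 4"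
  shows "\<bar>s - t\<bar> * norm (a - b) \<le> 8 * \<delta>"
  using assms(4-6)
proof (induction s t rule: linorder_wlog)
  case (le s t)
  define h where "h = (\<lambda>\<theta>. curved_proj f \<theta> a - curved_proj f \<theta> b)"
  have h_small: "\<bar>h s\<bar> \<le> \<delta>" "\<bar>h t\<bar> \<le> \<delta>"
    using le by (auto simp: h_def coincidence_angles_def)
  show ?case
  proof (cases "s = t")
    case True
    then show ?thesis using h_small by simp
  next
    case False
    have "(h has_real_derivative angular_speed \<theta> a - angular_speed \<theta> b) (at \<theta>)" for \<theta>
      unfolding h_def by (intro DERIV_diff curved_proj_has_derivative a b)
    then obtain \<theta> where \<theta>: "s < \<theta>" "\<theta> < t"
        and mvt: "h t - h s = (t - s) * (angular_speed \<theta> a - angular_speed \<theta> b)"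
      using MVT2[of s t h "\<lambda>\<theta>. angular_speed \<theta> a - angular_speed \<theta> b"] le False by auto
    have "norm (a - b) / 4 \<le> \<bar>angular_speed \<theta> a - angular_speed \<theta> b\<bar>"
      using le \<theta> by (intro angular_speed_diff_ge_near_coincidence[OF a b \<delta>, of s]) auto
    then have "\<bar>t - s\<bar> * (norm (a - b) / 4) \<le> \<bar>h t - h s\<bar>"
      unfolding mvt abs_mult by (intro mult_left_mono) auto
    also have "\<dots> \<le> 2 * \<delta>" using h_small by linarith
    finally show ?thesis by (simp add: abs_minus_commute)
  qed
qed (simp add: abs_minus_commute)

lemma measure_coincidence_angles_le:
  assumes "norm a < 2" "norm b < 2" "0 \<le> \<delta>" "\<delta> \<le> norm (a - b) / 4" "a \<noteq> b"
    and T: "compact T" "\<And>s t. s \<in> T \<Longrightarrow> t \<in> T \<Longrightarrow> \<bar>s - t\<bar> \<le> 1 / 4"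
  shows "measure lebesgue (coincidence_angles f \<delta> a b \<inter> T) \<le> 8 * \<delta> / norm (a - b)"
proof (rule measure_le_if_dist_le)
  show "coincidence_angles f \<delta> a b \<inter> T \<in> sets lebesgue"
    by (intro fmeasurableD coincidence_angles_Int_lmeasurable continuous T)
  show "\<bar>s - t\<bar> \<le> 8 * \<delta> / norm (a - b)"
    if "s \<in> coincidence_angles f \<delta> a b \<inter> T" "t \<in> coincidence_angles f \<delta> a b \<inter> T" for s t
    using coincidence_angles_close[OF assms(1,2,4), of s t] that T(2) \<open>a \<noteq> b\<close>
    by (simp add: pos_le_divide_eq)
qed (use assms in auto)

end

subsection \<open>Overlaps near the tiling direction\<close>

definition tiling_angle :: real where
  "tiling_angle = arctan (1 / 2)"

definition shell :: "nat \<Rightarrow> real set" where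
  "shell k = {tiling_angle + 1 / 4 ^ Suc k..tiling_angle + 1 / 4 ^ k}"

lemma tiling_angle_bounds: "0 \<le> tiling_angle" "tiling_angle \<le> 1 / 2"
  unfolding tiling_angle_def using arctan_le_self[of "1 / 2"] by (simp_all add: zero_le_arctan_iff)

lemma shell_subset: "shell k \<subseteq> {tiling_angle..tiling_angle + 1 / 4 ^ k}"
  by (auto simp: shell_def intro: order_trans[rotated])

lemma dist_shell_le: "s \<in> shell k \<Longrightarrow> t \<in> shell k \<Longrightarrow> \<bar>s - t\<bar> \<le> 1 / 4 ^ k"
  by (auto dest!: subsetD[OF shell_subset] simp: abs_le_iff)

lemma compact_shell: "compact (shell k)"
  by (simp add: shell_def)

lemma measure_shell: "measure lebesgue (shell k) = 3 / 4 / 4 ^ k"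
  by (simp add: shell_def field_simps)

lemma shell_subset_quadrant: "shell k \<subseteq> {0..pi / 2}"
proof -
  have "(1 :: real) / 4 ^ k \<le> 1" by simp
  then have "tiling_angle + 1 / 4 ^ k \<le> pi / 2"
    using tiling_angle_bounds(2) pi_gt3 by linarith
  then show ?thesis
    using shell_subset[of k] tiling_angle_bounds(1) by fastforce
qed

lemma Re_cis_tiling_angle_corner:
  assumes "m < 4 ^ n"
  shows "Re (cis (- tiling_angle) * corner n m) = 3 / sqrt 5 * real m / 4 ^ n"
proof -
  have hypotenuse: "sqrt (1 + (1 / 2)\<^sup>2) = sqrt 5 / 2"
    by (simp add: real_sqrt_divide power_divide)
  have "cos tiling_angle = 2 / sqrt 5" "sin tiling_angle = 1 / sqrt 5"
    unfolding tiling_angle_def cos_arctan sin_arctan hypotenuse by simp_all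
  then have "Re (cis (- tiling_angle) * corner n m) = (2 * Re (corner n m) + Im (corner n m)) / sqrt 5"
    by (simp add: add_divide_distrib)
  then show ?thesis unfolding two_Re_add_Im_corner[OF assms] by simp
qed

definition shell_overlap :: "(real \<Rightarrow> real) \<Rightarrow> nat \<Rightarrow> nat \<Rightarrow> nat \<Rightarrow> nat \<Rightarrow> real" where
  "shell_overlap f n k m m' =
    measure lebesgue (coincidence_angles f (1 / 4 ^ n) (corner n m) (corner n m') \<inter> shell k)"

lemma power_four_mult_self: "(4 :: real) ^ k * 4 ^ k = 16 ^ k"
  by (simp flip: power_mult_distrib)

lemma card_near_pairs_addresses_le:
  assumes "4 ^ k \<le> n"
  shows "card (near_pairs (4 ^ n) 17) * (1 / 4 ^ k) \<le> (4 ^ n * (35 * real n / 16 ^ k) :: real)"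
proof -
  have "real (4 ^ k) \<le> real n" using assms by (simp only: of_nat_le_iff)
  have "card (near_pairs (4 ^ n) 17) * (1 / 4 ^ k) \<le> 4 ^ n * 35 * (1 / 4 ^ k :: real)"
    using card_near_pairs_le[of 17 "4 ^ n"] by (intro mult_right_mono) auto
  also have "\<dots> = 4 ^ n * (35 * 4 ^ k / 16 ^ k)"
    unfolding power_four_mult_self[symmetric] by simp
  also have "\<dots> \<le> 4 ^ n * (35 * real n / 16 ^ k)"
    using \<open>real (4 ^ k) \<le> real n\<close> by (intro mult_left_mono divide_right_mono) auto
  finally show ?thesis .
qed

lemma card_straddling_pairs_addresses_le:
  assumes "k \<le> i" "i < n"
  shows "card (straddling_pairs (4 ^ n) (4 ^ i) (1 + 16 * (4 ^ i / 4 ^ k))) * (8 / 4 ^ i)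
    \<le> 4 ^ n * (9800 / 16 ^ k :: real)"
proof -
  define x :: real where "x = 4 ^ i / 4 ^ k"
  have "1 \<le> x" using \<open>k \<le> i\<close> by (simp add: x_def)
  have "(4 :: nat) ^ n = 4 ^ (n - i) * 4 ^ i" using \<open>i < n\<close> by (simp flip: power_add)
  then have "card (straddling_pairs (4 ^ n) (4 ^ i) (1 + 16 * x))
      \<le> 4 ^ (n - i) * (2 * (1 + 16 * x) + 1)\<^sup>2"
    using card_straddling_pairs_le[of "4 ^ i" "1 + 16 * x" "4 ^ (n - i)"] \<open>1 \<le> x\<close> by simp
  also have "\<dots> \<le> 4 ^ (n - i) * (35 * x)\<^sup>2"
    using \<open>1 \<le> x\<close> by (intro mult_left_mono power_mono) auto
  finally have "card (straddling_pairs (4 ^ n) (4 ^ i) (1 + 16 * x)) * (8 / 4 ^ i)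
      \<le> 4 ^ (n - i) * (35 * x)\<^sup>2 * (8 / 4 ^ i)"
    by (rule mult_right_mono) simp
  also have "\<dots> = 4 ^ n * (9800 / 16 ^ k)"
    unfolding power_four_mult_self[symmetric] using \<open>i < n\<close>
    by (simp add: x_def power_diff power2_eq_square)
  finally show ?thesis unfolding x_def .
qed

context flat_profile
begin

lemma address_diff_le_if_coincidence:
  assumes \<epsilon>: "\<epsilon> \<le> 1 / 4 ^ k" and m: "m < 4 ^ n" "m' < 4 ^ n"
    and i: "i < n" "top_differing_digit 4 i m m'"
    and \<theta>: "\<theta> \<in> coincidence_angles f (1 / 4 ^ n) (corner n m) (corner n m')" "\<theta> \<in> shell k"
  shows "\<bar>real m - real m'\<bar> \<le> 1 + 16 * (4 ^ i / 4 ^ k)"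
proof -
  let ?d = "corner n m - corner n m'"
  define x where "x = (real m - real m') / 4 ^ n"
  have "\<bar>\<theta> - tiling_angle\<bar> \<le> 1 / 4 ^ k"
    using \<theta>(2) shell_subset[of k] by auto
  then have "(\<epsilon> + \<bar>\<theta> - tiling_angle\<bar>) * norm ?d \<le> 2 / 4 ^ k * (8 * 4 ^ i / 4 ^ n)"
    using \<epsilon> \<epsilon>_nonneg norm_corner_diff_le[OF i] by (intro mult_mono) auto
  moreover have "\<bar>curved_proj f \<theta> (corner n m) - curved_proj f \<theta> (corner n m')\<bar> \<le> 1 / 4 ^ n"
    using \<theta>(1) by (simp add: coincidence_angles_def)
  ultimately have "\<bar>Re (cis (- tiling_angle) * ?d)\<bar> \<le> 1 / 4 ^ n + 2 / 4 ^ k * (8 * 4 ^ i / 4 ^ n)"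
    using curved_proj_diff_linear_le[OF norm_corner_less norm_corner_less, of \<theta> n m n m' tiling_angle]
    by linarith
  also have "\<dots> = (1 + 16 * (4 ^ i / 4 ^ k)) / 4 ^ n"
    by (simp add: add_divide_distrib)
  also have "Re (cis (- tiling_angle) * ?d) = 3 / sqrt 5 * x"
    using Re_cis_tiling_angle_corner[OF m(1)] Re_cis_tiling_angle_corner[OF m(2)]
    by (simp add: x_def right_diff_distrib diff_divide_distrib)
  finally have "3 / sqrt 5 * \<bar>x\<bar> \<le> (1 + 16 * (4 ^ i / 4 ^ k)) / 4 ^ n"
    by (simp add: abs_mult)
  moreover have "sqrt 5 \<le> 3" by (rule real_le_lsqrt) auto
  then have "1 * \<bar>x\<bar> \<le> 3 / sqrt 5 * \<bar>x\<bar>"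
    by (intro mult_right_mono) auto
  ultimately have "\<bar>real m - real m'\<bar> / 4 ^ n \<le> (1 + 16 * (4 ^ i / 4 ^ k)) / 4 ^ n"
    by (simp add: x_def)
  then show ?thesis by (simp add: divide_le_cancel)
qed

lemma shell_overlap_le: "shell_overlap f n k m m' \<le> 1 / 4 ^ k"
proof -
  have "shell_overlap f n k m m' \<le> measure lebesgue (shell k)"
    unfolding shell_overlap_def using compact_shell
    by (intro measure_mono_fmeasurable fmeasurableD coincidence_angles_Int_lmeasurable continuous
        lmeasurable_compact) auto
  then show ?thesis using divide_right_mono[of "3 / 4" 1 "4 ^ k :: real"] by (simp add: measure_shell)
qed

lemma shell_overlap_le_top_differing_digit:
  assumes "1 \<le> k" "k \<le> i" and i: "i < n" "top_differing_digit 4 i m m'"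
  shows "shell_overlap f n k m m' \<le> 8 / 4 ^ i"
proof -
  let ?d = "corner n m - corner n m'"
  have power_ge: "(4 :: real) \<le> 4 ^ j" if "1 \<le> j" for j
    using power_increasing[OF that, of "4 :: real"] by simp
  have dist: "4 ^ i / 4 ^ n \<le> norm ?d" by (rule norm_corner_diff_ge[OF i])
  then have "0 < norm ?d" by (rule less_le_trans[rotated]) simp
  have "4 / 4 ^ n \<le> (4 ^ i / 4 ^ n :: real)"
    using power_ge[of i] assms by (intro divide_right_mono) auto
  then have "1 / 4 ^ n \<le> norm ?d / 4" using dist by linarith
  moreover have "1 / 4 ^ k \<le> (1 / 4 :: real)"
    using power_ge[OF \<open>1 \<le> k\<close>] by (simp add: field_simps)
  then have "\<bar>s - t\<bar> \<le> 1 / 4" if "s \<in> shell k" "t \<in> shell k" for s t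
    using dist_shell_le[OF that] by linarith
  ultimately have "shell_overlap f n k m m' \<le> 8 * (1 / 4 ^ n) / norm ?d"
    unfolding shell_overlap_def using \<open>0 < norm ?d\<close>
    by (intro measure_coincidence_angles_le norm_corner_less compact_shell) auto
  also have "\<dots> \<le> 8 * (1 / 4 ^ n) / (4 ^ i / 4 ^ n)"
    using dist \<open>0 < norm ?d\<close> by (intro divide_left_mono) auto
  finally show ?thesis by simp
qed

lemma shell_overlap_le_sum:
  assumes "1 \<le> k" and \<epsilon>: "\<epsilon> \<le> 1 / 4 ^ k" and m: "m < 4 ^ n" "m' < 4 ^ n"
  shows "shell_overlap f n k m m' \<le> of_bool ((m, m') \<in> near_pairs (4 ^ n) 17) * (1 / 4 ^ k) +
    (\<Sum>i\<in>{k..<n}.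
      of_bool ((m, m') \<in> straddling_pairs (4 ^ n) (4 ^ i) (1 + 16 * (4 ^ i / 4 ^ k))) * (8 / 4 ^ i))"
    (is "_ \<le> ?near + (\<Sum>i\<in>_. ?far i)")
proof -
  have far_nonneg: "0 \<le> sum ?far {k..<n}" by (simp add: sum_nonneg)
  show ?thesis
  proof (cases "(m, m') \<in> near_pairs (4 ^ n) 17 \<or>
      coincidence_angles f (1 / 4 ^ n) (corner n m) (corner n m') \<inter> shell k = {}")
    case True
    then show ?thesis
      using shell_overlap_le[of n k m m'] far_nonneg by (auto simp: shell_overlap_def)
  next
    case False
    then obtain \<theta> where
      \<theta>: "\<theta> \<in> coincidence_angles f (1 / 4 ^ n) (corner n m) (corner n m')" "\<theta> \<in> shell k"
      by blast
    have "m \<noteq> m'" using False m by (auto simp: near_pairs_def)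
    then obtain i where i: "i < n" "top_differing_digit 4 i m m'"
      by (rule top_differing_digit_exists[OF m])
    have close: "\<bar>real m - real m'\<bar> \<le> 1 + 16 * (4 ^ i / 4 ^ k)"
      by (rule address_diff_le_if_coincidence[OF \<epsilon> m i \<theta>])
    have "k \<le> i"
    proof (rule ccontr)
      assume "\<not> k \<le> i"
      then have "4 ^ i / 4 ^ k \<le> (1 :: real)" by simp
      then have "\<bar>real m - real m'\<bar> \<le> 17" using close by linarith
      then show False using False m by (simp add: near_pairs_def)
    qed
    then have "shell_overlap f n k m m' \<le> 8 / 4 ^ i"
      using i \<open>1 \<le> k\<close> by (intro shell_overlap_le_top_differing_digit)
    also have "\<dots> = ?far i"
      using close m div_neq_if_top_differing_digit[OF i(2)]
      by (simp add: straddling_pairs_def near_pairs_def)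
    also have "\<dots> \<le> sum ?far {k..<n}"
      using \<open>k \<le> i\<close> i(1) by (intro member_le_sum) auto
    finally show ?thesis by (rule order_trans) simp
  qed
qed

lemma sum_shell_overlap_le:
  assumes k: "1 \<le> k" "4 ^ k \<le> n" and \<epsilon>: "\<epsilon> \<le> 1 / 4 ^ k"
  shows "(\<Sum>(m, m')\<in>{..<4 ^ n} \<times> {..<4 ^ n}. shell_overlap f n k m m') \<le> 4 ^ n * (10 ^ 4 * real n / 16 ^ k)"
proof -
  let ?A = "{..<4 ^ n :: nat} \<times> {..<4 ^ n :: nat}"
  let ?near = "near_pairs (4 ^ n) 17"
  let ?far = "\<lambda>i. straddling_pairs (4 ^ n) (4 ^ i) (1 + 16 * (4 ^ i / 4 ^ k))"
  have card_eq: "(\<Sum>p\<in>?A. of_bool (p \<in> S) * c) = card S * c" if "S \<subseteq> ?A" for S and c :: real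
    using that by (simp add: Int_absorb1)
  have "(\<Sum>(m, m')\<in>?A. shell_overlap f n k m m')
      \<le> (\<Sum>p\<in>?A. of_bool (p \<in> ?near) * (1 / 4 ^ k) + (\<Sum>i\<in>{k..<n}. of_bool (p \<in> ?far i) * (8 / 4 ^ i)))"
    by (intro sum_mono, clarify, rule shell_overlap_le_sum[OF k(1) \<epsilon>])
  also have "\<dots> = card ?near * (1 / 4 ^ k) + (\<Sum>i\<in>{k..<n}. card (?far i) * (8 / 4 ^ i))"
    unfolding sum.distrib sum.swap[of _ "{k..<n}" ?A]
    using near_pairs_subset straddling_pairs_subset
    by (intro arg_cong2[where f = "(+)"] sum.cong refl card_eq)
  also have "\<dots> \<le> 4 ^ n * (35 * real n / 16 ^ k) + real (card {k..<n}) * (4 ^ n * (9800 / 16 ^ k))"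
    using card_near_pairs_addresses_le[OF k(2)]
    by (intro add_mono sum_bounded_above card_straddling_pairs_addresses_le) auto
  also have "\<dots> \<le> 4 ^ n * (35 * real n / 16 ^ k) + real n * (4 ^ n * (9800 / 16 ^ k))"
    by (intro add_left_mono mult_right_mono) auto
  also have "\<dots> \<le> 4 ^ n * (10 ^ 4 * real n / 16 ^ k)"
    by (simp add: field_simps)
  finally show ?thesis .
qed

lemma integral_shadow_length_shell_ge:
  assumes k: "1 \<le> k" "4 ^ k \<le> n" and \<epsilon>: "\<epsilon> \<le> 1 / 4 ^ k"
  shows "1 / (2 * 10 ^ 4 * real n) \<le> integral (shell k) (shadow_length f (K_stage n))"
proof -
  define t where "t = 4 ^ k / (10 ^ 4 * real n)"
  let ?overlaps = "\<Sum>(m, m')\<in>{..<4 ^ n} \<times> {..<4 ^ n}. shell_overlap f n k m m'"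
  have "0 < n" using k(2) by (cases n) auto
  have "t\<^sup>2 * (1 / 4 ^ n * ?overlaps) \<le> t\<^sup>2 * (1 / 4 ^ n * (4 ^ n * (10 ^ 4 * real n / 16 ^ k)))"
    by (intro mult_left_mono sum_shell_overlap_le k \<epsilon>) auto
  also have "\<dots> = 1 / (10 ^ 4 * real n)"
    unfolding power_four_mult_self[symmetric] using \<open>0 < n\<close> by (simp add: t_def power2_eq_square)
  finally have "1 / (2 * 10 ^ 4 * real n) \<le> 2 * t * (3 / 4 / 4 ^ k) - t\<^sup>2 * (1 / 4 ^ n * ?overlaps)"
    using \<open>0 < n\<close> by (simp add: t_def field_simps)
  also have "\<dots> \<le> integral (shell k) (shadow_length f (K_stage n))"
    using integral_shadow_length_ge[OF continuous compact_K_stage compact_shell,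
        where A = "{..<4 ^ n}" and \<delta> = "1 / 4 ^ n" and c = "corner n" and t = t]
      corner_ray_mem_K_stage shell_subset_quadrant
    by (simp add: measure_shell shell_overlap_def subset_iff)
  finally show ?thesis .
qed

lemma integral_shadow_length_shells_ge:
  assumes "4 ^ K \<le> n" and "\<epsilon> \<le> 1 / 4 ^ K"
  shows "real K / (2 * 10 ^ 4 * real n)
    \<le> integral {tiling_angle + 1 / 4 ^ Suc K..tiling_angle + 1 / 4} (shadow_length f (K_stage n))"
  using assms
proof (induction K)
  case (Suc K)
  let ?a = "\<lambda>k. tiling_angle + 1 / 4 ^ k" and ?shadow = "shadow_length f (K_stage n)"
  have "(1 :: real) / 4 ^ Suc K \<le> 1 / 4 ^ K" by (simp add: field_simps)
  then have "real K / (2 * 10 ^ 4 * real n) \<le> integral {?a (Suc K)..tiling_angle + 1 / 4} ?shadow"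
    using Suc.prems by (intro Suc.IH) auto
  moreover have "1 / (2 * 10 ^ 4 * real n) \<le> integral {?a (Suc (Suc K))..?a (Suc K)} ?shadow"
    using integral_shadow_length_shell_ge[of "Suc K" n] Suc.prems by (simp add: shell_def)
  moreover have "integral {?a (Suc (Suc K))..?a (Suc K)} ?shadow +
      integral {?a (Suc K)..tiling_angle + 1 / 4} ?shadow =
      integral {?a (Suc (Suc K))..tiling_angle + 1 / 4} ?shadow"
    by (intro Henstock_Kurzweil_Integration.integral_combine
        shadow_length_integrable_on continuous compact_K_stage) (auto simp: field_simps)
  ultimately show ?case by (simp add: add_divide_distrib)
qed simp

end

subsection \<open>Circular profiles\<close>

lemma half_radius_le_sqrt:
  fixes r y :: real
  assumes "2 * \<bar>y\<bar> \<le> r"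
  shows "r / 2 \<le> sqrt (r\<^sup>2 - y\<^sup>2)"
proof (rule real_le_rsqrt)
  have "(2 * \<bar>y\<bar>)\<^sup>2 \<le> r\<^sup>2" using assms by (intro power_mono) auto
  then have "4 * y\<^sup>2 \<le> r\<^sup>2" by (simp add: power_mult_distrib)
  moreover have "(r / 2)\<^sup>2 = r\<^sup>2 / 4" by (simp add: power_divide)
  ultimately show "(r / 2)\<^sup>2 \<le> r\<^sup>2 - y\<^sup>2"
    using zero_le_power2[of r] by linarith
qed

lemma sqrt_circle_lipschitz:
  fixes r x y :: real
  assumes "0 < r" and x: "2 * \<bar>x\<bar> \<le> r" and y: "2 * \<bar>y\<bar> \<le> r"
  shows "\<bar>sqrt (r\<^sup>2 - x\<^sup>2) - sqrt (r\<^sup>2 - y\<^sup>2)\<bar> \<le> \<bar>x - y\<bar>"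
proof -
  define X Y where "X = sqrt (r\<^sup>2 - x\<^sup>2)" and "Y = sqrt (r\<^sup>2 - y\<^sup>2)"
  have sqrt_ge: "r / 2 \<le> X" "r / 2 \<le> Y"
    unfolding X_def Y_def using x y by (simp_all only: half_radius_le_sqrt)
  then have "0 \<le> sqrt (r\<^sup>2 - x\<^sup>2)" "0 \<le> sqrt (r\<^sup>2 - y\<^sup>2)"
    using \<open>0 < r\<close> unfolding X_def Y_def by linarith+
  then have "X\<^sup>2 = r\<^sup>2 - x\<^sup>2" "Y\<^sup>2 = r\<^sup>2 - y\<^sup>2" by (simp_all add: X_def Y_def)
  then have "(X - Y) * (X + Y) = - (x - y) * (x + y)"
    by (simp add: algebra_simps power2_eq_square)
  then have "\<bar>X - Y\<bar> * \<bar>X + Y\<bar> = \<bar>x - y\<bar> * \<bar>x + y\<bar>" by (metis abs_minus_cancel abs_mult)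
  also have "\<dots> \<le> \<bar>x - y\<bar> * r" using x y by (intro mult_left_mono) auto
  finally have "\<bar>X - Y\<bar> * \<bar>X + Y\<bar> \<le> \<bar>x - y\<bar> * r" .
  moreover have "\<bar>X - Y\<bar> * r \<le> \<bar>X - Y\<bar> * \<bar>X + Y\<bar>" using sqrt_ge by (intro mult_left_mono) auto
  ultimately have "\<bar>X - Y\<bar> * r \<le> \<bar>x - y\<bar> * r" by linarith
  then show ?thesis using \<open>0 < r\<close> by (simp add: X_def Y_def)
qed

lemma circle_slope_lipschitz:
  fixes r x y :: real
  assumes "0 < r" and x: "2 * \<bar>x\<bar> \<le> r" and y: "2 * \<bar>y\<bar> \<le> r"
  shows "\<bar>x / sqrt (r\<^sup>2 - x\<^sup>2) - y / sqrt (r\<^sup>2 - y\<^sup>2)\<bar> \<le> 4 / r * \<bar>x - y\<bar>"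
proof -
  define X Y where "X = sqrt (r\<^sup>2 - x\<^sup>2)" and "Y = sqrt (r\<^sup>2 - y\<^sup>2)"
  have sqrt_ge: "r / 2 \<le> X" "r / 2 \<le> Y"
    unfolding X_def Y_def using x y by (simp_all only: half_radius_le_sqrt)
  then have sqrt_pos: "0 < X" "0 < Y" using \<open>0 < r\<close> by auto
  have "\<bar>y / Y\<bar> \<le> 1" using y sqrt_ge sqrt_pos by simp
  have "\<bar>x / X - y / Y\<bar> = \<bar>(x - y) - y / Y * (X - Y)\<bar> / X"
    using sqrt_pos by (simp add: field_simps)
  also have "\<dots> \<le> (\<bar>x - y\<bar> + \<bar>y / Y\<bar> * \<bar>X - Y\<bar>) / X"
    using sqrt_pos
    by (intro divide_right_mono) (auto intro: order_trans[OF abs_triangle_ineq4] simp: abs_mult)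
  also have "\<dots> \<le> (\<bar>x - y\<bar> + 1 * \<bar>x - y\<bar>) / (r / 2)"
    using sqrt_ge sqrt_pos \<open>0 < r\<close> \<open>\<bar>y / Y\<bar> \<le> 1\<close> sqrt_circle_lipschitz[OF assms]
    unfolding X_def[symmetric] Y_def[symmetric]
    by (intro frac_le add_mono mult_mono) auto
  also have "\<dots> = 4 / r * \<bar>x - y\<bar>" by simp
  finally show ?thesis unfolding X_def Y_def .
qed

lemma continuous_on_f_r: "continuous_on UNIV (f_r r)"
proof -
  have "f_r r = (\<lambda>y. r - sqrt (r\<^sup>2 - min (y\<^sup>2) 4))"
    using abs_le_square_iff[of _ "2 :: real"] by (auto simp: f_r_def min_def fun_eq_iff)
  then show ?thesis by (simp only:) (intro continuous_intros)
qed

lemma f_r_has_derivative: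
  assumes "4 \<le> r" "\<bar>y\<bar> < 2"
  shows "(f_r r has_real_derivative y / sqrt (r\<^sup>2 - y\<^sup>2)) (at y)"
proof -
  have "0 < sqrt (r\<^sup>2 - y\<^sup>2)" using half_radius_le_sqrt[of y r] assms by linarith
  then have "((\<lambda>y. r - sqrt (r\<^sup>2 - y\<^sup>2)) has_real_derivative y / sqrt (r\<^sup>2 - y\<^sup>2)) (at y)"
    by (auto intro!: derivative_eq_intros simp: field_simps)
  then show ?thesis
    by (rule has_field_derivative_transform_within_open[of _ _ _ "{-2<..<2}"])
       (use assms in \<open>auto simp: f_r_def\<close>)
qed

lemma f_r_flat_profile:
  assumes "64 \<le> r"
  shows "flat_profile (f_r r) (\<lambda>y. y / sqrt (r\<^sup>2 - y\<^sup>2)) (4 / r)"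
proof
  show "continuous_on UNIV (f_r r)" by (rule continuous_on_f_r)
  show "(f_r r has_real_derivative y / sqrt (r\<^sup>2 - y\<^sup>2)) (at y)" if "\<bar>y\<bar> < 2" for y
    using assms that by (intro f_r_has_derivative) auto
  show "\<bar>x / sqrt (r\<^sup>2 - x\<^sup>2) - y / sqrt (r\<^sup>2 - y\<^sup>2)\<bar> \<le> 4 / r * \<bar>x - y\<bar>" if "\<bar>x\<bar> < 2" "\<bar>y\<bar> < 2" for x y
    using assms that by (intro circle_slope_lipschitz) auto
  show "\<bar>y / sqrt (r\<^sup>2 - y\<^sup>2)\<bar> \<le> 4 / r" if "\<bar>y\<bar> < 2" for y
  proof -
    have sqrt_ge: "r / 2 \<le> sqrt (r\<^sup>2 - y\<^sup>2)" using assms that by (intro half_radius_le_sqrt) auto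
    then have "\<bar>y\<bar> / sqrt (r\<^sup>2 - y\<^sup>2) \<le> 2 / (r / 2)" using assms that by (intro frac_le) auto
    moreover have "0 \<le> sqrt (r\<^sup>2 - y\<^sup>2)" using sqrt_ge assms by linarith
    ultimately show ?thesis by (simp only: abs_divide abs_of_nonneg) simp
  qed
  show "4 / r \<le> 1 / 16" using assms by (simp add: field_simps)
qed

lemma proj_coord_sigma_map: "proj_coord \<theta> (sigma_map r z (cis \<theta>)) = curved_proj (f_r r) \<theta> z"
proof -
  have "cis (Arg (cis \<theta>)) = cis \<theta>" by (simp add: cis_Arg)
  moreover from this have "cis (- Arg (cis \<theta>)) = cis (- \<theta>)" by (metis cis_cnj)
  ultimately have "proj_coord \<theta> (sigma_map r z (cis \<theta>))
      = Re ((cis \<theta> * cis (- \<theta>)) * sigma0 r (cis (- \<theta>) * z))"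
    by (simp only: proj_coord_def sigma_map_def rot_cw_def minus_minus cis_cnj ac_simps)
  then show ?thesis by (simp add: cis_mult sigma0_def curved_proj_def)
qed

lemma Fav_sigma_map:
  "Fav (sigma_map r) K = 1 / (2 * pi) * integral {0..2 * pi} (shadow_length (f_r r) K)"
  unfolding Fav_def proj_length_def image_image proj_coord_sigma_map shadow_length_def ..

lemma Fav_sigma_map_ge:
  assumes "compact K" "0 \<le> u" "v \<le> 2 * pi"
  shows "1 / (2 * pi) * integral {u..v} (shadow_length (f_r r) K) \<le> Fav (sigma_map r) K"
  unfolding Fav_sigma_map using assms
  by (intro mult_left_mono integral_subset_le shadow_length_integrable_on continuous_on_f_r)
     (auto simp: shadow_length_def)

lemma Fav_sigma_map_K_stage_pos: "0 < Fav (sigma_map r) (K_stage n)"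
proof -
  have "1 / 4 ^ n \<le> integral {0..1} (shadow_length (f_r r) (K_stage n))"
    using integral_shadow_length_ge[OF continuous_on_f_r compact_K_stage,
        where T = "{0..1}" and A = "{0}" and \<delta> = "1 / 4 ^ n" and c = "corner n" and t = 1]
      corner_ray_mem_K_stage pi_gt3
    by (simp add: coincidence_angles_def)
  then have "1 / (2 * pi) * (1 / 4 ^ n)
      \<le> 1 / (2 * pi) * integral {0..1} (shadow_length (f_r r) (K_stage n))"
    by (intro mult_left_mono) auto
  also have "\<dots> \<le> Fav (sigma_map r) (K_stage n)"
    using pi_gt3 by (intro Fav_sigma_map_ge compact_K_stage) auto
  finally show ?thesis by (rule less_le_trans[rotated]) simp
qed

lemma Fav_sigma_map_K_stage_ge_log:
  assumes "64 \<le> r" "4 * real n \<le> r" "4 \<le> n"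
  shows "1 / (8 * pi * 10 ^ 4 * ln 4) * (ln (real n) / real n) \<le> Fav (sigma_map r) (K_stage n)"
proof -
  interpret flat_profile "f_r r" "\<lambda>y. y / sqrt (r\<^sup>2 - y\<^sup>2)" "4 / r"
    using assms by (intro f_r_flat_profile)
  obtain K where K: "4 ^ K \<le> n" "n < 4 ^ (K + 1)"
    using ex_power_ivl1[of 4 n] assms by auto
  have "K \<noteq> 0" using K \<open>4 \<le> n\<close> by (cases K) auto
  have "real (4 ^ K) \<le> real n" "real n < real (4 ^ Suc K)"
    using K by (simp_all only: of_nat_le_iff of_nat_less_iff Suc_eq_plus1)
  then have powers: "4 ^ K \<le> real n" "real n < 4 ^ Suc K" by simp_all
  have "4 * 4 ^ K \<le> r" using powers(1) \<open>4 * real n \<le> r\<close> by linarith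
  then have "4 / r \<le> 1 / 4 ^ K" using \<open>64 \<le> r\<close> by (simp add: field_simps)
  have "ln (real n) \<le> ln (4 ^ Suc K)" using powers(2) \<open>4 \<le> n\<close> by (intro ln_mono) auto
  also have "\<dots> = real (Suc K) * ln 4" by (rule ln_realpow)
  also have "\<dots> \<le> (2 * real K) * ln 4" using \<open>K \<noteq> 0\<close> by (intro mult_right_mono) auto
  finally have "ln (real n) / ln 4 \<le> 2 * real K" by (simp add: field_simps)
  then have "1 / (8 * pi * 10 ^ 4 * real n) * (ln (real n) / ln 4)
      \<le> 1 / (8 * pi * 10 ^ 4 * real n) * (2 * real K)"
    by (intro mult_left_mono) auto
  also have "\<dots> = 1 / (2 * pi) * (real K / (2 * 10 ^ 4 * real n))" by simp
  also have "\<dots> \<le> 1 / (2 * pi) *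
      integral {tiling_angle + 1 / 4 ^ Suc K..tiling_angle + 1 / 4} (shadow_length (f_r r) (K_stage n))"
    using \<open>4 / r \<le> 1 / 4 ^ K\<close> K by (intro mult_left_mono integral_shadow_length_shells_ge) auto
  also have "\<dots> \<le> Fav (sigma_map r) (K_stage n)"
    using tiling_angle_bounds pi_gt3 by (intro Fav_sigma_map_ge compact_K_stage) auto
  finally show ?thesis by (simp add: ac_simps)
qed

theorem theorem2:
  fixes r :: "nat \<Rightarrow> real"
  assumes "\<forall>n\<ge>1. r n \<ge> 4 powr (real n / 5)"
  shows "undercooked r"
proof -
  have "\<forall>\<^sub>F n in sequentially. 64 \<le> 4 powr (real n / 5) \<and> 4 * real n \<le> 4 powr (real n / 5) \<and> 4 \<le> n"
    by (intro eventually_conj eventually_ge_at_top) real_asymp+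
  then have large: "\<forall>\<^sub>F n in sequentially. 1 / (8 * pi * 10 ^ 4 * ln 4) * (ln (real n) / real n)
      \<le> Fav (sigma_map (r n)) (K_stage n)"
  proof eventually_elim
    case (elim n)
    then have "4 powr (real n / 5) \<le> r n" using assms by simp
    with elim show ?case by (intro Fav_sigma_map_K_stage_ge_log) auto
  qed
  have nonneg: "0 \<le> ln (real n) / real n" for n
    by (cases n) auto
  have "\<exists>C>0. \<forall>n. C * (ln (real n) / real n) \<le> Fav (sigma_map (r n)) (K_stage n)"
    by (rule ex_pos_mult_le_if_eventually[OF Fav_sigma_map_K_stage_pos nonneg _ large]) simp
  then show ?thesis
    by (auto simp: undercooked_def undercooking_def)
qed

end
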